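(* Let $\mu,\omega:\mathbb{Z}\to\mathbb{R}^+$ be growth rates such that $\mu$ is faster than $\omega$. Suppose that the system $x(k+1)=A(k)x(k)$, $k\in\mathbb{Z}$, admits a $\mu$-dichotomy. Then its $\omega$-dichotomy spectrum $\Sigma_{\omega\mathrm{D}}(A)$ is equal to either $\{+\infty\}$, $\{-\infty\}$ or $\{-\infty,+\infty\}$.
   Context: System: $A:\mathbb{Z}\to GL_d(\mathbb{R})$, and $x(k+1)=A(k)x(k)$, $k\in\mathbb{Z}$. Its evolution operator is $\Phi(k,n)=A(k-1)\cdots A(n)$ for $k>n$, $\Phi(n,n)=\mathrm{Id}$, $\Phi(k,n)=A^{-1}(k)\cdots A^{-1}(n-1)$ for $k<n$. Growth rate: a non-decreasing map $\mu:\mathbb{Z}\to\mathbb{R}^+=(0,\infty)$ with $\mu(0)=1$, $\lim_{n\to+\infty}\mu(n)=+\infty$, $\lim_{n\to-\infty}\mu(n)=0$. Faster: $\mu$ is faster than $\omega$ if for every $\alpha,\tilde\alpha<0$ there is $M\ge1$ such that $\left(\frac{\mu(k)}{\mu(n)}\right)^{\alpha}\le M\left(\frac{\omega(k)}{\omega(n)}\right)^{\tilde\alpha}$ for all integers $k\ge n$. Invariant projector: a map $n\mapsto \mathrm{P}(n)$ of idempotent $d\times d$ matrices with $A(k)\mathrm{P}(k)=\mathrm{P}(k+1)A(k)$ for all $k\in\mathbb{Z}$. $\mu$-dichotomy ($\mu$D): there are an invariant projector $\mathrm{P}$ and constants $K\ge1$, $\alpha<0$, $\beta>0$ with $\|\Phi(k,n)\mathrm{P}(n)\|\le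 K\left(\frac{\mu(k)}{\mu(n)}\right)^{\alpha}$ for all $k\ge n$ and $\|\Phi(k,n)[\mathrm{Id}-\mathrm{P}(n)]\|\le K\left(\frac{\mu(k)}{\mu(n)}\right)^{\beta}$ for all $k\le n$. Weighted system: for $\gamma\in\mathbb{R}$ the $(\mu,\gamma)$-weighted system is $x(k+1)=A(k)\left(\frac{\mu(k+1)}{\mu(k)}\right)^{-\gamma}x(k)$. By convention, the weighted system for $\gamma=+\infty$ admits $\mu$D if there is $\hat\gamma\in\mathbb{R}$ such that the $(\mu,\hat\gamma)$-weighted system admits $\mu$D with projector $\mathrm{P}\equiv\mathrm{Id}$; for $\gamma=-\infty$ it admits $\mu$D if there is $\hat\gamma\in\mathbb{R}$ such that the $(\mu,\hat\gamma)$-weighted system admits $\mu$D with projector $\mathrm{P}\equiv0$. Spectrum: $\Sigma_{\mu\mathrm{D}}(A)=\{\gamma\in\mathbb{R}\cup\{\pm\infty\}:\text{the }(\mu,\gamma)\text{-weighted system does not admit }\mu\mathrm{D}\}$; likewise with $\omega$ in place of $\mu$. *)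

theory Defs
  imports "HOL-Analysis.Analysis"
begin

text \<open>A \<open>d\<close>-dimensional system \<open>x(k+1) = A(k) x(k)\<close> is given by its coefficient map
  \<open>A :: int \<Rightarrow> real^'d^'d\<close>, with \<open>d = CARD('d) \<ge> 1\<close>. That the values lie in \<open>GL\<^sub>d\<close> is a
  separate hypothesis, \<open>\<forall>k. invertible (A k)\<close>.\<close>

primrec forward_evolution :: "(int \<Rightarrow> real^'d^'d) \<Rightarrow> int \<Rightarrow> nat \<Rightarrow> real^'d^'d" where
  "forward_evolution A n 0 = mat 1"
| "forward_evolution A n (Suc j) = A (n + int j) ** forward_evolution A n j"

primrec backward_evolution :: "(int \<Rightarrow> real^'d^'d) \<Rightarrow> int \<Rightarrow> nat \<Rightarrow> real^'d^'d" where
  "backward_evolution A n 0 = mat 1"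
| "backward_evolution A n (Suc j) =
     matrix_inv (A (n - int (Suc j))) ** backward_evolution A n j"

text \<open>\<open>evolution A k n\<close> is \<open>\<Phi>(k,n)\<close>: the product \<open>A(k-1) \<cdots> A(n)\<close> for \<open>k > n\<close>, the identity for
  \<open>k = n\<close>, and \<open>A(k)\<^sup>-\<^sup>1 \<cdots> A(n-1)\<^sup>-\<^sup>1\<close> for \<open>k < n\<close>.\<close>

definition evolution :: "(int \<Rightarrow> real^'d^'d) \<Rightarrow> int \<Rightarrow> int \<Rightarrow> real^'d^'d" where
  "evolution A k n =
     (if n \<le> k then forward_evolution A n (nat (k - n))
      else backward_evolution A n (nat (n - k)))"

definition growth_rate :: "(int \<Rightarrow> real) \<Rightarrow> bool" where
  "growth_rate \<mu> \<longleftrightarrow>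
     (\<forall>n. 0 < \<mu> n) \<and> mono \<mu> \<and> \<mu> 0 = 1 \<and>
     filterlim \<mu> at_top at_top \<and> (\<mu> \<longlongrightarrow> 0) at_bot"

definition faster :: "(int \<Rightarrow> real) \<Rightarrow> (int \<Rightarrow> real) \<Rightarrow> bool" where
  "faster \<mu> \<omega> \<longleftrightarrow>
     (\<forall>\<alpha><0. \<forall>\<alpha>'<0. \<exists>M\<ge>1. \<forall>k n. n \<le> k \<longrightarrow>
        (\<mu> k / \<mu> n) powr \<alpha> \<le> M * (\<omega> k / \<omega> n) powr \<alpha>')"

definition invariant_projector ::
    "(int \<Rightarrow> real^'d^'d) \<Rightarrow> (int \<Rightarrow> real^'d^'d) \<Rightarrow> bool" where
  "invariant_projector A P \<longleftrightarrow>
     (\<forall>n. P n ** P n = P n) \<and> (\<forall>k. A k ** P k = P (k + 1) ** A k)"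

definition matrix_opnorm :: "real^'d^'d \<Rightarrow> real" where
  "matrix_opnorm B = onorm (\<lambda>x. B *v x)"

definition dichotomy_with ::
    "(int \<Rightarrow> real) \<Rightarrow> (int \<Rightarrow> real^'d^'d) \<Rightarrow> (int \<Rightarrow> real^'d^'d) \<Rightarrow> bool" where
  "dichotomy_with \<mu> A P \<longleftrightarrow>
     invariant_projector A P \<and>
     (\<exists>K \<alpha> \<beta>. 1 \<le> K \<and> \<alpha> < 0 \<and> 0 < \<beta> \<and>
        (\<forall>k n. n \<le> k \<longrightarrow>
           matrix_opnorm (evolution A k n ** P n) \<le> K * (\<mu> k / \<mu> n) powr \<alpha>) \<and>
        (\<forall>k n. k \<le> n \<longrightarrow>
           matrix_opnorm (evolution A k n ** (mat 1 - P n)) \<le> K * (\<mu> k / \<mu> n) powr \<beta>))"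

definition admits_dichotomy :: "(int \<Rightarrow> real) \<Rightarrow> (int \<Rightarrow> real^'d^'d) \<Rightarrow> bool" where
  "admits_dichotomy \<mu> A \<longleftrightarrow> (\<exists>P. dichotomy_with \<mu> A P)"

definition weighted ::
    "(int \<Rightarrow> real) \<Rightarrow> real \<Rightarrow> (int \<Rightarrow> real^'d^'d) \<Rightarrow> int \<Rightarrow> real^'d^'d" where
  "weighted \<mu> \<gamma> A k = ((\<mu> (k + 1) / \<mu> k) powr (- \<gamma>)) *\<^sub>R A k"

fun weighted_admits_dichotomy ::
    "(int \<Rightarrow> real) \<Rightarrow> (int \<Rightarrow> real^'d^'d) \<Rightarrow> ereal \<Rightarrow> bool" where
  "weighted_admits_dichotomy \<mu> A (ereal \<gamma>) \<longleftrightarrow> admits_dichotomy \<mu> (weighted \<mu> \<gamma> A)"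
| "weighted_admits_dichotomy \<mu> A PInfty \<longleftrightarrow>
     (\<exists>\<gamma>'. dichotomy_with \<mu> (weighted \<mu> \<gamma>' A) (\<lambda>_. mat 1))"
| "weighted_admits_dichotomy \<mu> A MInfty \<longleftrightarrow>
     (\<exists>\<gamma>'. dichotomy_with \<mu> (weighted \<mu> \<gamma>' A) (\<lambda>_. 0))"

definition dichotomy_spectrum ::
    "(int \<Rightarrow> real) \<Rightarrow> (int \<Rightarrow> real^'d^'d) \<Rightarrow> ereal set" where
  "dichotomy_spectrum \<mu> A = {\<gamma>. \<not> weighted_admits_dichotomy \<mu> A \<gamma>}"

end

theory Submission
  imports Defs
begin

text \<open>
  A power of \<open>\<mu>\<close> with negative exponent decays faster than every power of \<open>\<omega>\<close>. Passing from the
  system to its \<open>(\<omega>,\<gamma>)\<close>-weighted system multiplies \<open>\<Phi>(k,n)\<close> by a fixed power of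
  \<open>\<omega>(k)/\<omega>(n)\<close>, and the \<open>\<mu>\<close>-estimates absorb such a factor while leaving a decaying power
  of \<open>\<omega>\<close> over. Hence one and the same projector \<open>P\<close> gives an \<open>\<omega>\<close>-dichotomy of all
  weighted systems with real \<open>\<gamma>\<close> (\<open>dichotomy_with_weighted_if_faster\<close>), so the spectrum
  contains no real number.

  What remains is that the spectrum is not empty. A dichotomy on the whole of \<open>\<int>\<close> determines
  its projector (\<open>dichotomy_projector_unique\<close>). If \<open>+\<infinity>\<close> were outside the spectrum, some real
  weight would give a dichotomy with the projector \<open>Id\<close>, whence \<open>P = Id\<close>; if \<open>-\<infinity>\<close> were outside,
  then \<open>P = 0\<close>. As the dimension is positive, not both can happen.
\<close>

section \<open>The evolution operator\<close>

lemma matrix_diff_ldistrib: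
  fixes B C D :: "real^'d^'d"
  shows "B ** (C - D) = B ** C - B ** D"
  by (vector matrix_matrix_mult_def sum_subtractf[symmetric] right_diff_distrib)

lemma matrix_diff_rdistrib:
  fixes B C D :: "real^'d^'d"
  shows "(B - C) ** D = B ** D - C ** D"
  by (vector matrix_matrix_mult_def sum_subtractf[symmetric] left_diff_distrib)

lemma
  fixes B :: "real^'d^'d"
  assumes "invertible B"
  shows matrix_inv_left: "matrix_inv B ** B = mat 1"
    and matrix_inv_right: "B ** matrix_inv B = mat 1"
  using someI_ex[OF assms[unfolded invertible_def]] by (auto simp: matrix_inv_def)

text \<open>
  Every identity for the evolution operator below (cocycle law, commutation with an invariant
  projector, effect of a weight) is an instance of this: both sides solve the matrix equation and
  agree at one time.
\<close>

lemma matrix_solution_unique: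
  fixes A X Y :: "int \<Rightarrow> real^'d^'d"
  assumes inv: "\<And>k. invertible (A k)"
    and X: "\<And>k. X (k + 1) = A k ** X k"
    and Y: "\<And>k. Y (k + 1) = A k ** Y k"
    and eq: "X n = Y n"
  shows "X k = Y k"
proof (induction k rule: int_induct[where k = n])
  case base
  show ?case by (rule eq)
next
  case (step1 i)
  then show ?case by (simp add: X Y)
next
  case (step2 i)
  have "A (i - 1) ** X (i - 1) = A (i - 1) ** Y (i - 1)"
    using X[of "i - 1"] Y[of "i - 1"] step2 by simp
  then have "matrix_inv (A (i - 1)) ** (A (i - 1) ** X (i - 1)) =
      matrix_inv (A (i - 1)) ** (A (i - 1) ** Y (i - 1))"
    by simp
  then show ?case
    by (simp add: matrix_mul_assoc matrix_inv_left[OF inv])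
qed

lemma evolution_refl [simp]: "evolution A n n = mat 1"
  by (simp add: evolution_def)

lemma evolution_step:
  fixes A :: "int \<Rightarrow> real^'d^'d"
  assumes inv: "\<And>k. invertible (A k)"
  shows "evolution A (k + 1) n = A k ** evolution A k n"
proof (cases "n \<le> k")
  case True
  then have "nat (k + 1 - n) = Suc (nat (k - n))" by simp
  with True show ?thesis by (simp add: evolution_def)
next
  case False
  define j where "j = nat (n - k - 1)"
  have j: "nat (n - k) = Suc j" "n - int (Suc j) = k"
    using False by (auto simp: j_def)
  have "evolution A k n = matrix_inv (A k) ** backward_evolution A n j"
    using False j by (simp add: evolution_def)
  moreover have "evolution A (k + 1) n = backward_evolution A n j"
    using False by (cases "k + 1 = n") (auto simp: evolution_def j_def algebra_simps)
  ultimately show ?thesis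
    by (simp add: matrix_mul_assoc matrix_inv_right[OF inv])
qed

lemma evolution_cocycle:
  fixes A :: "int \<Rightarrow> real^'d^'d"
  assumes inv: "\<And>k. invertible (A k)"
  shows "evolution A m k ** evolution A k n = evolution A m n"
  by (rule matrix_solution_unique[of A "\<lambda>m. evolution A m k ** evolution A k n"
        "\<lambda>m. evolution A m n" k])
    (simp_all add: inv evolution_step[OF inv] matrix_mul_assoc)

lemma evolution_invariant_projector:
  fixes A :: "int \<Rightarrow> real^'d^'d"
  assumes inv: "\<And>k. invertible (A k)" and P: "invariant_projector A P"
  shows "P k ** evolution A k n = evolution A k n ** P n"
proof (rule matrix_solution_unique[of A "\<lambda>k. P k ** evolution A k n"
      "\<lambda>k. evolution A k n ** P n" n])
  fix k
  have "A k ** P k = P (k + 1) ** A k"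
    using P by (simp add: invariant_projector_def)
  then show "P (k + 1) ** evolution A (k + 1) n = A k ** (P k ** evolution A k n)"
    by (simp add: evolution_step[OF inv] matrix_mul_assoc)
qed (simp_all add: inv evolution_step[OF inv] matrix_mul_assoc)

lemma growth_rate_pos: "growth_rate \<omega> \<Longrightarrow> 0 < \<omega> n"
  by (simp add: growth_rate_def)

lemma growth_rate_mono: "growth_rate \<omega> \<Longrightarrow> n \<le> k \<Longrightarrow> \<omega> n \<le> \<omega> k"
  by (simp add: growth_rate_def mono_def)

lemma invertible_weighted:
  assumes "growth_rate \<omega>" "invertible (A k)"
  shows "invertible (weighted \<omega> \<gamma> A k)"
  unfolding weighted_def
  by (rule scalar_invertible)
    (use assms growth_rate_pos[OF assms(1), of k] growth_rate_pos[OF assms(1), of "k + 1"] in auto)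

lemma evolution_weighted:
  fixes A :: "int \<Rightarrow> real^'d^'d"
  assumes \<omega>: "growth_rate \<omega>" and inv: "\<And>k. invertible (A k)"
  shows "evolution (weighted \<omega> \<gamma> A) k n = (\<omega> k / \<omega> n) powr (- \<gamma>) *\<^sub>R evolution A k n"
proof (rule matrix_solution_unique[of "weighted \<omega> \<gamma> A" "\<lambda>k. evolution (weighted \<omega> \<gamma> A) k n"
      "\<lambda>k. (\<omega> k / \<omega> n) powr (- \<gamma>) *\<^sub>R evolution A k n" n])
  note pos = growth_rate_pos[OF \<omega>]
  fix k
  have "(\<omega> (k + 1) / \<omega> n) powr (- \<gamma>) =
      (\<omega> (k + 1) / \<omega> k) powr (- \<gamma>) * (\<omega> k / \<omega> n) powr (- \<gamma>)"
    using pos[of k] pos[of "k + 1"] pos[of n] by (simp flip: powr_mult)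
  then show "(\<omega> (k + 1) / \<omega> n) powr (- \<gamma>) *\<^sub>R evolution A (k + 1) n =
      weighted \<omega> \<gamma> A k ** ((\<omega> k / \<omega> n) powr (- \<gamma>) *\<^sub>R evolution A k n)"
    by (simp add: weighted_def evolution_step[OF inv] matrix_scalar_ac
        flip: scalar_matrix_assoc)
qed (use growth_rate_pos[OF \<omega>, of n] in
    \<open>simp_all add: invertible_weighted[OF \<omega>] inv evolution_step\<close>)

section \<open>The operator norm of a matrix\<close>

lemma matrix_opnorm_nonneg: "0 \<le> matrix_opnorm B"
  unfolding matrix_opnorm_def by (rule onorm_pos_le) (rule matrix_vector_mul_bounded_linear)

lemma matrix_opnorm_mult: "matrix_opnorm (B ** C) \<le> matrix_opnorm B * matrix_opnorm C"
  unfolding matrix_opnorm_def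
  using onorm_compose[OF matrix_vector_mul_bounded_linear[of B] matrix_vector_mul_bounded_linear[of C]]
  by (simp add: comp_def matrix_vector_mul_assoc)

lemma matrix_opnorm_scaleR: "matrix_opnorm (c *\<^sub>R B) = \<bar>c\<bar> * matrix_opnorm B"
  unfolding matrix_opnorm_def
  using onorm_scaleR[OF matrix_vector_mul_bounded_linear[of B], of c]
  by (simp add: scaleR_matrix_vector_assoc)

lemma matrix_eq_0_if_opnorm_le_tendsto_0:
  fixes B :: "real^'d^'d" and F :: "int filter"
  assumes "F \<noteq> bot" "(f \<longlongrightarrow> 0) F" "\<forall>\<^sub>F k in F. matrix_opnorm B \<le> f k"
  shows "B = 0"
proof -
  have "matrix_opnorm B \<le> 0"
    using assms by (intro tendsto_lowerbound[OF assms(2)]) auto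
  then have "onorm (\<lambda>x. B *v x) = 0"
    using matrix_opnorm_nonneg[of B] by (simp add: matrix_opnorm_def)
  then have "\<forall>x. B *v x = 0"
    using onorm_eq_0[OF matrix_vector_mul_bounded_linear[of B]] by simp
  then show ?thesis
    by (simp add: matrix_eq)
qed

section \<open>Uniqueness of the projector\<close>

lemma growth_rate_quotient_powr_at_top:
  assumes "growth_rate \<omega>" "0 < \<beta>"
  shows "((\<lambda>k. (\<omega> n / \<omega> k) powr \<beta>) \<longlongrightarrow> 0) at_top"
proof (rule tendsto_zero_powrI)
  have "filterlim \<omega> at_infinity at_top"
    using assms(1) by (auto simp: growth_rate_def intro: filterlim_at_top_imp_at_infinity)
  then show "((\<lambda>k. \<omega> n / \<omega> k) \<longlongrightarrow> 0) at_top"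
    by (rule tendsto_divide_0[OF tendsto_const])
  show "\<forall>\<^sub>F k in at_top. 0 \<le> \<omega> n / \<omega> k"
    using growth_rate_pos[OF assms(1)] by (simp add: less_imp_le)
qed (use assms(2) in auto)

lemma growth_rate_quotient_powr_at_bot:
  assumes "growth_rate \<omega>" "0 < \<beta>"
  shows "((\<lambda>k. (\<omega> k / \<omega> n) powr \<beta>) \<longlongrightarrow> 0) at_bot"
proof (rule tendsto_zero_powrI)
  have "(\<omega> \<longlongrightarrow> 0) at_bot"
    using assms(1) by (simp add: growth_rate_def)
  then show "((\<lambda>k. \<omega> k / \<omega> n) \<longlongrightarrow> 0) at_bot"
    by (rule tendsto_divide_zero)
  show "\<forall>\<^sub>F k in at_bot. 0 \<le> \<omega> k / \<omega> n"
    using growth_rate_pos[OF assms(1)] by (simp add: less_imp_le)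
qed (use assms(2) in auto)

text \<open>
  Transport \<open>(Id - P(n))Q(n)\<close> to a late time \<open>k\<close>: it equals
  \<open>\<Phi>(n,k)(Id - P(k)) \<cdot> \<Phi>(k,n)Q(n)\<close>, where the first factor tends to zero as \<open>k \<rightarrow> +\<infinity>\<close> and the
  second stays bounded, so it vanishes. In the same way \<open>P(n)(Id - Q(n))\<close> vanishes by letting
  \<open>k \<rightarrow> -\<infinity>\<close>. Thus \<open>Q(n) = P(n)Q(n) = P(n)\<close>.
\<close>

lemma dichotomy_projector_unique:
  fixes A :: "int \<Rightarrow> real^'d^'d"
  assumes \<omega>: "growth_rate \<omega>" and inv: "\<And>k. invertible (A k)"
    and P: "dichotomy_with \<omega> A P" and Q: "dichotomy_with \<omega> A Q"
  shows "P n = Q n"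
proof -
  let ?\<Phi> = "evolution A"
  note pos = growth_rate_pos[OF \<omega>] and mono = growth_rate_mono[OF \<omega>]
  have commP: "P k ** ?\<Phi> k n = ?\<Phi> k n ** P n" for k
    using P by (intro evolution_invariant_projector inv) (simp add: dichotomy_with_def)
  have return: "?\<Phi> n k ** ?\<Phi> k n = mat 1" for k
    by (simp add: evolution_cocycle[OF inv])
  obtain K \<alpha> \<beta> where K: "1 \<le> K" "\<alpha> < 0" "0 < \<beta>"
    and Pfwd: "\<And>k n. n \<le> k \<Longrightarrow> matrix_opnorm (?\<Phi> k n ** P n) \<le> K * (\<omega> k / \<omega> n) powr \<alpha>"
    and Pbwd: "\<And>k n. k \<le> n \<Longrightarrow>
      matrix_opnorm (?\<Phi> k n ** (mat 1 - P n)) \<le> K * (\<omega> k / \<omega> n) powr \<beta>"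
    using P unfolding dichotomy_with_def by metis
  obtain L \<alpha>' \<beta>' where L: "1 \<le> L" "\<alpha>' < 0" "0 < \<beta>'"
    and Qfwd: "\<And>k n. n \<le> k \<Longrightarrow> matrix_opnorm (?\<Phi> k n ** Q n) \<le> L * (\<omega> k / \<omega> n) powr \<alpha>'"
    and Qbwd: "\<And>k n. k \<le> n \<Longrightarrow>
      matrix_opnorm (?\<Phi> k n ** (mat 1 - Q n)) \<le> L * (\<omega> k / \<omega> n) powr \<beta>'"
    using Q unfolding dichotomy_with_def by metis
  have le1: "(\<omega> k / \<omega> m) powr a \<le> 1" if "m \<le> k" "a < 0" for k m a
    using that pos[of m] pos[of k] mono[of m k] powr_mono[of a 0 "\<omega> k / \<omega> m"] by simp
  have fwd0: "(mat 1 - P n) ** Q n = 0"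
  proof (rule matrix_eq_0_if_opnorm_le_tendsto_0)
    show "((\<lambda>k. K * (\<omega> n / \<omega> k) powr \<beta> * L) \<longlongrightarrow> 0) at_top"
      using growth_rate_quotient_powr_at_top[OF \<omega> K(3), of n]
      by (intro tendsto_mult_left_zero tendsto_mult_right_zero)
    have "matrix_opnorm ((mat 1 - P n) ** Q n) \<le> K * (\<omega> n / \<omega> k) powr \<beta> * L" if k: "n \<le> k" for k
    proof -
      have "(?\<Phi> n k ** (mat 1 - P k)) ** (?\<Phi> k n ** Q n) =
          ?\<Phi> n k ** ((mat 1 - P k) ** ?\<Phi> k n) ** Q n"
        by (simp add: matrix_mul_assoc)
      also have "(mat 1 - P k) ** ?\<Phi> k n = ?\<Phi> k n ** (mat 1 - P n)"
        by (simp add: matrix_diff_ldistrib matrix_diff_rdistrib commP)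
      also have "?\<Phi> n k ** (?\<Phi> k n ** (mat 1 - P n)) ** Q n = (mat 1 - P n) ** Q n"
        by (simp add: matrix_mul_assoc return)
      finally have "matrix_opnorm ((mat 1 - P n) ** Q n) \<le>
          matrix_opnorm (?\<Phi> n k ** (mat 1 - P k)) * matrix_opnorm (?\<Phi> k n ** Q n)"
        using matrix_opnorm_mult by metis
      also have "\<dots> \<le> K * (\<omega> n / \<omega> k) powr \<beta> * L"
      proof (rule mult_mono)
        show "matrix_opnorm (?\<Phi> k n ** Q n) \<le> L"
          using Qfwd[OF k] mult_left_mono[OF le1[OF k L(2)], of L] L(1) by linarith
      qed (use Pbwd[OF k] K(1) in \<open>auto simp: matrix_opnorm_nonneg\<close>)
      finally show ?thesis .
    qed
    then show "\<forall>\<^sub>F k in at_top. matrix_opnorm ((mat 1 - P n) ** Q n) \<le> K * (\<omega> n / \<omega> k) powr \<beta> * L"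
      by (auto simp: eventually_at_top_linorder)
  qed simp
  have bwd0: "P n ** (mat 1 - Q n) = 0"
  proof (rule matrix_eq_0_if_opnorm_le_tendsto_0)
    show "((\<lambda>k. K * (L * (\<omega> k / \<omega> n) powr \<beta>')) \<longlongrightarrow> 0) at_bot"
      using growth_rate_quotient_powr_at_bot[OF \<omega> L(3), of n]
      by (intro tendsto_mult_right_zero)
    have "matrix_opnorm (P n ** (mat 1 - Q n)) \<le> K * (L * (\<omega> k / \<omega> n) powr \<beta>')" if k: "k \<le> n" for k
    proof -
      have "(?\<Phi> n k ** P k) ** (?\<Phi> k n ** (mat 1 - Q n)) =
          ?\<Phi> n k ** (P k ** ?\<Phi> k n) ** (mat 1 - Q n)"
        by (simp add: matrix_mul_assoc)
      also have "\<dots> = P n ** (mat 1 - Q n)"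
        by (simp add: commP matrix_mul_assoc return)
      finally have "matrix_opnorm (P n ** (mat 1 - Q n)) \<le>
          matrix_opnorm (?\<Phi> n k ** P k) * matrix_opnorm (?\<Phi> k n ** (mat 1 - Q n))"
        using matrix_opnorm_mult by metis
      also have "\<dots> \<le> K * (L * (\<omega> k / \<omega> n) powr \<beta>')"
      proof (rule mult_mono)
        show "matrix_opnorm (?\<Phi> n k ** P k) \<le> K"
          using Pfwd[OF k] mult_left_mono[OF le1[OF k K(2)], of K] K(1) by linarith
      qed (use Qbwd[OF k] K(1) in \<open>auto simp: matrix_opnorm_nonneg\<close>)
      finally show ?thesis .
    qed
    then show "\<forall>\<^sub>F k in at_bot. matrix_opnorm (P n ** (mat 1 - Q n)) \<le> K * (L * (\<omega> k / \<omega> n) powr \<beta>')"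
      by (auto simp: eventually_at_bot_linorder)
  qed simp
  have "Q n = P n ** Q n" "P n = P n ** Q n"
    using fwd0 bwd0 by (simp_all add: matrix_diff_ldistrib matrix_diff_rdistrib)
  then show ?thesis by simp
qed

section \<open>Weights of a slower growth rate\<close>

lemma invariant_projector_weighted:
  assumes "invariant_projector A P"
  shows "invariant_projector (weighted \<omega> \<gamma> A) P"
  using assms by (simp add: invariant_projector_def weighted_def matrix_scalar_ac
        flip: scalar_matrix_assoc)

text \<open>
  The weight contributes the factor \<open>(\<omega>(k)/\<omega>(n)) powr (-\<gamma>)\<close>. Since \<open>\<mu>\<close> is faster, both
  \<open>\<mu>\<close>-estimates may be exchanged for \<open>\<omega>\<close>-estimates with any exponent of the same sign: \<open>\<gamma> - c\<close> forward
  and \<open>\<gamma> + c\<close> backward with \<open>c = \<bar>\<gamma>\<bar> + 1\<close> have the required signs, and after weighting there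
  remain the exponents \<open>- c\<close> and \<open>c\<close>.
\<close>

lemma dichotomy_with_weighted_if_faster:
  fixes A :: "int \<Rightarrow> real^'d^'d"
  assumes \<mu>: "growth_rate \<mu>" and \<omega>: "growth_rate \<omega>" and faster: "faster \<mu> \<omega>"
    and inv: "\<And>k. invertible (A k)" and P: "dichotomy_with \<mu> A P"
  shows "dichotomy_with \<omega> (weighted \<omega> \<gamma> A) P"
proof -
  let ?\<Phi> = "evolution A" and ?\<Psi> = "evolution (weighted \<omega> \<gamma> A)"
  define c where "c = \<bar>\<gamma>\<bar> + 1"
  have c: "0 < c" "\<gamma> - c < 0" "- (\<gamma> + c) < 0" by (auto simp: c_def)
  note pos\<mu> = growth_rate_pos[OF \<mu>] and pos\<omega> = growth_rate_pos[OF \<omega>]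
  obtain K \<alpha> \<beta> where K: "1 \<le> K" "\<alpha> < 0" "0 < \<beta>"
    and fwd: "\<And>k n. n \<le> k \<Longrightarrow> matrix_opnorm (?\<Phi> k n ** P n) \<le> K * (\<mu> k / \<mu> n) powr \<alpha>"
    and bwd: "\<And>k n. k \<le> n \<Longrightarrow>
      matrix_opnorm (?\<Phi> k n ** (mat 1 - P n)) \<le> K * (\<mu> k / \<mu> n) powr \<beta>"
    using P unfolding dichotomy_with_def by metis
  obtain M where M: "1 \<le> M"
    "\<And>k n. n \<le> k \<Longrightarrow> (\<mu> k / \<mu> n) powr \<alpha> \<le> M * (\<omega> k / \<omega> n) powr (\<gamma> - c)"
    using faster K(2) c(2) unfolding faster_def by metis
  have "- \<beta> < 0" using K(3) by simp
  then obtain N where N: "1 \<le> N"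
    "\<And>k n. n \<le> k \<Longrightarrow> (\<mu> k / \<mu> n) powr (- \<beta>) \<le> N * (\<omega> k / \<omega> n) powr (- (\<gamma> + c))"
    using faster c(3) unfolding faster_def by metis
  have swap: "(x / y) powr (- a) = (y / x) powr a" if "0 < x" "0 < y" for x y a :: real
    using that by (simp add: powr_minus powr_divide)
  have weigh: "matrix_opnorm (?\<Psi> k n ** B) \<le> K * max M N * (\<omega> k / \<omega> n) powr e"
    if B: "matrix_opnorm (?\<Phi> k n ** B) \<le> K * m" "m \<le> L * (\<omega> k / \<omega> n) powr (\<gamma> + e)"
      "L \<le> max M N"
    for k n B m L e
  proof -
    let ?r = "\<omega> k / \<omega> n"
    have "matrix_opnorm (?\<Psi> k n ** B) = ?r powr (- \<gamma>) * matrix_opnorm (?\<Phi> k n ** B)"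
      by (simp add: evolution_weighted[OF \<omega> inv] matrix_opnorm_scaleR flip: scalar_matrix_assoc)
    also have "\<dots> \<le> ?r powr (- \<gamma>) * (K * (max M N * ?r powr (\<gamma> + e)))"
    proof (rule mult_left_mono)
      have "m \<le> max M N * ?r powr (\<gamma> + e)"
        using B(2) mult_right_mono[OF B(3) powr_ge_zero[of ?r "\<gamma> + e"]] by linarith
      then show "matrix_opnorm (?\<Phi> k n ** B) \<le> K * (max M N * ?r powr (\<gamma> + e))"
        using B(1) K(1) by (intro order_trans[OF B(1)] mult_left_mono) auto
    qed simp
    also have "\<dots> = K * max M N * (?r powr (- \<gamma>) * ?r powr (\<gamma> + e))"
      by simp
    also have "?r powr (- \<gamma>) * ?r powr (\<gamma> + e) = ?r powr e"
      by (simp flip: powr_add)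
    finally show ?thesis .
  qed
  have "matrix_opnorm (?\<Psi> k n ** P n) \<le> K * max M N * (\<omega> k / \<omega> n) powr (- c)"
    if "n \<le> k" for k n
    using weigh[OF fwd[OF that], of M "- c"] M(2)[OF that] by simp
  moreover have "matrix_opnorm (?\<Psi> k n ** (mat 1 - P n)) \<le> K * max M N * (\<omega> k / \<omega> n) powr c"
    if "k \<le> n" for k n
  proof (rule weigh[OF bwd[OF that]])
    show "(\<mu> k / \<mu> n) powr \<beta> \<le> N * (\<omega> k / \<omega> n) powr (\<gamma> + c)"
      using N(2)[OF that] by (simp only: swap pos\<mu> pos\<omega>)
  qed simp
  moreover have "1 \<le> K * max M N"
    using K(1) M(1) mult_mono[of 1 K 1 "max M N"] by simp
  moreover have "invariant_projector (weighted \<omega> \<gamma> A) P"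
    using P by (intro invariant_projector_weighted) (simp add: dichotomy_with_def)
  moreover have "- c < 0" using c(1) by simp
  ultimately show ?thesis
    using c(1) unfolding dichotomy_with_def by blast
qed

section \<open>The spectrum with respect to a slower growth rate\<close>

theorem theorem3p7:
  fixes \<mu> \<omega> :: "int \<Rightarrow> real" and A :: "int \<Rightarrow> real^'d^'d"
  assumes "growth_rate \<mu>" and "growth_rate \<omega>"
    and "faster \<mu> \<omega>"
    and "\<forall>k. invertible (A k)"
    and "admits_dichotomy \<mu> A"
  shows "dichotomy_spectrum \<omega> A = {\<infinity>} \<or>
    dichotomy_spectrum \<omega> A = {-\<infinity>} \<or>
    dichotomy_spectrum \<omega> A = {-\<infinity>, \<infinity>}"
proof -
  obtain P where "dichotomy_with \<mu> A P"
    using assms(5) by (auto simp: admits_dichotomy_def)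
  then have P: "dichotomy_with \<omega> (weighted \<omega> \<gamma> A) P" for \<gamma>
    using assms(1-4) by (blast intro: dichotomy_with_weighted_if_faster)
  have unique: "Q 0 = P 0" if "dichotomy_with \<omega> (weighted \<omega> \<gamma> A) Q" for Q \<gamma>
    by (rule dichotomy_projector_unique[OF assms(2) _ that P])
      (use assms(2,4) in \<open>auto intro: invertible_weighted\<close>)
  have real: "ereal \<gamma> \<notin> dichotomy_spectrum \<omega> A" for \<gamma>
    using P[of \<gamma>] by (auto simp: dichotomy_spectrum_def admits_dichotomy_def)
  have top: "P 0 = mat 1" if notin: "\<infinity> \<notin> dichotomy_spectrum \<omega> A"
  proof -
    obtain \<gamma> where "dichotomy_with \<omega> (weighted \<omega> \<gamma> A) (\<lambda>_. mat 1)"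
      using notin weighted_admits_dichotomy.simps(2)[of \<omega> A]
      unfolding dichotomy_spectrum_def infinity_ereal_def by blast
    from unique[OF this] show ?thesis by simp
  qed
  have bot: "P 0 = 0" if notin: "-\<infinity> \<notin> dichotomy_spectrum \<omega> A"
  proof -
    obtain \<gamma> where "dichotomy_with \<omega> (weighted \<omega> \<gamma> A) (\<lambda>_. 0)"
      using notin weighted_admits_dichotomy.simps(3)[of \<omega> A]
      unfolding dichotomy_spectrum_def MInfty_eq_minfinity by blast
    from unique[OF this] show ?thesis by simp
  qed
  have "\<infinity> \<in> dichotomy_spectrum \<omega> A \<or> -\<infinity> \<in> dichotomy_spectrum \<omega> A"
  proof (rule ccontr)
    assume "\<not> ?thesis"
    then have "mat 1 = (0 :: real^'d^'d)"
      using top bot by auto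
    then have "(mat 1 :: real^'d^'d) $ i $ i = 0" for i
      by simp
    then show False
      by (simp add: mat_def)
  qed
  moreover have "dichotomy_spectrum \<omega> A \<subseteq> {-\<infinity>, \<infinity>}"
    using real by (metis ereal_cases insertI1 insertI2 subsetI)
  ultimately show ?thesis
    by blast
qed

end
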